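(* Let $x\in\overline{\Lambda}$ and $y\in\Lambda$. Then $G=P_xNP_y$.
   Context: Setting. $K$ is a finite extension of $\mathbb{Q}_p$ with valuation $v$ normalized so that a prime element has valuation $1$ (and $v(0)=\infty$); $V$ is an $n$-dimensional $K$-vector space with fixed basis $v_1,\dots,v_n$; $\underline{n}=\{1,\dots,n\}$. $G=PGL(V)$ denotes the group of $K$-rational points. $T\subseteq G$ is the image of the diagonal matrices, $N\subseteq G$ is its normalizer, i.e. the image of the monomial matrices; $N=T\rtimes W$ with $W$ the group of permutation matrices, $w(v_i)=v_{w(i)}$. $\Lambda=X_*(T)\otimes\mathbb{R}=\sum_{i=1}^n\mathbb{R}\eta_i$ subject to the single relation $\sum_i\eta_i=0$. Roots: $\Phi=\{a_{ij}:i\neq j\}$, $a_{ij}(\sum x_k\eta_k)=x_i-x_j$. Compactified apartment. For nonempty $I\subseteq\underline{n}$ let $\Lambda_I=\sum_{i\in I}\mathbb{R}\eta_i^I$ with the single relation $\sum_{i\in I}\eta_i^I=0$, and $r_I:\Lambda\to\Lambda_I$, $r_I(\sum_{i=1}^n x_i\eta_i)=\sum_{i\in I}x_i\eta_i^I$; $\Lambda_{\underline{n}}=\Lambda$. $\overline{\Lambda}$ is the disjoint union $\bigcup_{\emptyset\ne I\subseteq\underline{n}}\Lambda_I$, with topology having as base the open subsets of $\Lambda$ together with the sets $C_U^I=(U+D_I)\cup\bigcup_{I\subseteq J\subsetneq\underline{n}}r_J(U+D_I)$ for nonempty $I\subsetneq\underline{n}$ and bounded open $U\subseteq\Lambda$,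 where $D_I=\sum_{i\notin I}\mathbb{R}_{\ge0}(-\eta_i)$. $N$ acts on $\overline{\Lambda}$ via $\nu$: $w\in W$ maps $\Lambda_I$ to $\Lambda_{w(I)}$ linearly by $\eta_i^I\mapsto\eta_{w(i)}^{w(I)}$, and $t\in T$ induced by $\mathrm{diag}(t_1,\dots,t_n)$ acts on $\Lambda_I$ by translation by $-\sum_{i\in I}v(t_i)\eta_i^I$. Groups. For $a=a_{ij}$, $U_a\subseteq G$ is the image of the group of unipotent matrices $v_j\mapsto v_j+\omega v_i$, $v_l\mapsto v_l$ ($l\ne j$), $\omega\in K$; $\psi_a(u)=v(\omega)$. For $x\in\overline{\Lambda}$, $f_x(a)=\inf\{t\in\mathbb{R}: x\in\overline{\{z\in\Lambda:a(z)\ge -t\}}\}$ (closure in $\overline{\Lambda}$; $\inf\emptyset=\infty$, $\inf\mathbb{R}=-\infty$), $U_{a,x}=\{u\in U_a:\psi_a(u)\ge f_x(a)\}$ (so it is $\{1\}$ if $f_x(a)=\infty$ and $U_a$ if $f_x(a)=-\infty$), $U_x$ is the subgroup of $G$ generated by all $U_{a,x}$, $a\in\Phi$; $N_x=\{n\in N:\nu(n)x=x\}$; $P_x=U_xN_x=N_xU_x$ (a group). *)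

theory Defs
  imports
    "HOL-Analysis.Analysis"
    "HOL-Algebra.Group_Action"
    "HOL-Algebra.Generated_Groups"
    "HOL-Computational_Algebra.Primes"
begin

section \<open>Finite extensions of the p-adic numbers\<close>

definition normalized_valuation :: "('k::field \<Rightarrow> ereal) \<Rightarrow> bool" where
  "normalized_valuation v \<longleftrightarrow>
     v 0 = \<infinity> \<and>
     (\<forall>x. x \<noteq> 0 \<longrightarrow> (\<exists>k::int. v x = ereal (of_int k))) \<and>
     (\<forall>x y. v (x * y) = v x + v y) \<and>
     (\<forall>x y. min (v x) (v y) \<le> v (x + y)) \<and>
     (\<exists>\<pi>. v \<pi> = 1)"

text \<open>
  The libraries do not provide the field of p-adic numbers, so it is described by its definition as
  the completion of the rationals: a field that is complete for a valuation, in which the rationals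
  are dense, and whose valuation induces the p-adic one on the rationals.  It sits here as a
  subfield F of the larger field carrying v.  As v is normalized on the larger field, v is on
  the rationals only a positive multiple (the ramification index e) of the p-adic valuation.
\<close>

definition is_padic_subfield :: "nat \<Rightarrow> ('k::field_char_0 \<Rightarrow> ereal) \<Rightarrow> 'k set \<Rightarrow> bool" where
  "is_padic_subfield p v F \<longleftrightarrow>
     0 \<in> F \<and> 1 \<in> F \<and>
     (\<forall>x\<in>F. \<forall>y\<in>F. x - y \<in> F \<and> x * y \<in> F) \<and> (\<forall>x\<in>F. inverse x \<in> F) \<and>
     (\<exists>e::nat. e > 0 \<and>
        (\<forall>m::int. m \<noteq> 0 \<longrightarrow> v (of_int m) = ereal (real (e * multiplicity (int p) m)))) \<and>
     (\<forall>x\<in>F. \<forall>M::real. \<exists>q::rat. ereal M \<le> v (x - of_rat q)) \<and>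
     (\<forall>s::nat \<Rightarrow> 'k. (\<forall>n. s n \<in> F) \<and>
           (\<forall>M::real. \<exists>N. \<forall>m\<ge>N. \<forall>n\<ge>N. ereal M \<le> v (s m - s n)) \<longrightarrow>
        (\<exists>l\<in>F. \<forall>M::real. \<exists>N. \<forall>n\<ge>N. ereal M \<le> v (s n - l)))"

definition finite_extension_of_Qp :: "nat \<Rightarrow> ('k::field_char_0 \<Rightarrow> ereal) \<Rightarrow> bool" where
  "finite_extension_of_Qp p v \<longleftrightarrow>
     prime p \<and> normalized_valuation v \<and>
     (\<exists>F. is_padic_subfield p v F \<and>
       (\<exists>B. finite B \<and> (\<forall>x. \<exists>c. (\<forall>b\<in>B. c b \<in> F) \<and> x = (\<Sum>b\<in>B. c b * b))))"


section \<open>The group PGL(V) and its subgroups\<close>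

text \<open>
  The index set is a finite type 'n, and V is identified with the coordinate space through its
  fixed basis, so that a matrix A sends the j-th basis vector to its j-th column.
\<close>

definition GL :: "('k::field ^ 'n ^ 'n) monoid" where
  "GL = \<lparr>carrier = {A. invertible A}, mult = (**), one = mat 1\<rparr>"

definition scalars :: "('k::field ^ 'n ^ 'n) set" where
  "scalars = {mat c | c. c \<noteq> 0}"

definition PGL :: "('k::field ^ 'n ^ 'n) set monoid" where
  "PGL = GL Mod scalars"

definition proj :: "'k::field ^ 'n ^ 'n \<Rightarrow> ('k ^ 'n ^ 'n) set" where
  "proj A = scalars #>\<^bsub>GL\<^esub> A"

definition diag_mat :: "'k::field ^ 'n \<Rightarrow> 'k ^ 'n ^ 'n" where
  "diag_mat t = (\<chi> i j. if i = j then t $ i else 0)"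

definition perm_mat :: "('n::finite \<Rightarrow> 'n) \<Rightarrow> 'k::field ^ 'n ^ 'n" where
  "perm_mat w = (\<chi> i j. if i = w j then 1 else 0)"

definition elem_mat :: "'n::finite \<Rightarrow> 'n \<Rightarrow> 'k::field \<Rightarrow> 'k ^ 'n ^ 'n" where
  "elem_mat i j \<omega> = (\<chi> k l. if k = l then 1 else if k = i \<and> l = j then \<omega> else 0)"

definition torus :: "('k::field ^ 'n ^ 'n) set set" where
  "torus = {proj (diag_mat t) | t. \<forall>i. t $ i \<noteq> 0}"

definition torus_normalizer :: "('k::field ^ 'n ^ 'n) set set" where
  "torus_normalizer = normalizer PGL torus"


section \<open>The compactified apartment\<close>

text \<open>
  The quotient of the real space with basis eta_i (i in I) by the line spanned by the sum of the
  basis vectors is represented by cosets.  To have one type for all I, a vector indexed by I is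
  replaced by the set of all vectors on the full index set that extend it; the index set I is
  recorded as the first component, which makes the union over I disjoint.
\<close>

type_synonym 'n apt_point = "'n set \<times> (real ^ 'n) set"

text \<open>\<open>pt I x\<close> is the class of the sum of all x_i eta_i^I with i in I.\<close>

definition pt :: "('n::finite) set \<Rightarrow> real ^ 'n \<Rightarrow> 'n apt_point" where
  "pt I x = (I, {y. \<exists>c. \<forall>i\<in>I. y $ i = x $ i + c})"

lemma pt_eq_iff: "pt I x = pt J y \<longleftrightarrow> I = J \<and> (\<exists>c. \<forall>i\<in>I. y $ i = x $ i + c)"
proof
  assume h: "pt I x = pt J y"
  then have "I = J" and "{z. \<exists>c. \<forall>i\<in>I. z $ i = x $ i + c} = {z. \<exists>c. \<forall>i\<in>J. z $ i = y $ i + c}"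
    unfolding pt_def prod.inject by blast+
  moreover have "y \<in> {z. \<exists>c. \<forall>i\<in>J. z $ i = y $ i + c}"
    unfolding mem_Collect_eq by (rule exI[of _ 0]) simp
  ultimately show "I = J \<and> (\<exists>c. \<forall>i\<in>I. y $ i = x $ i + c)"
    by blast
next
  assume "I = J \<and> (\<exists>c. \<forall>i\<in>I. y $ i = x $ i + c)"
  then obtain c where "I = J" and c: "\<And>i. i \<in> I \<Longrightarrow> y $ i = x $ i + c"
    by blast
  have "(\<exists>d. \<forall>i\<in>I. z $ i = x $ i + d) \<longleftrightarrow> (\<exists>d. \<forall>i\<in>I. z $ i = y $ i + d)" for z
  proof
    assume "\<exists>d. \<forall>i\<in>I. z $ i = x $ i + d"
    then obtain d where "\<forall>i\<in>I. z $ i = x $ i + d" ..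
    then show "\<exists>d. \<forall>i\<in>I. z $ i = y $ i + d"
      using c by (intro exI[of _ "d - c"]) simp
  next
    assume "\<exists>d. \<forall>i\<in>I. z $ i = y $ i + d"
    then obtain d where "\<forall>i\<in>I. z $ i = y $ i + d" ..
    then show "\<exists>d. \<forall>i\<in>I. z $ i = x $ i + d"
      using c by (intro exI[of _ "d + c"]) simp
  qed
  then show "pt I x = pt J y"
    using \<open>I = J\<close> by (simp add: pt_def)
qed

definition Lambda_face :: "('n::finite) set \<Rightarrow> 'n apt_point set" where
  "Lambda_face I = range (pt I)"

definition Lambda :: "('n::finite) apt_point set" where
  "Lambda = Lambda_face UNIV"

definition Lambda_bar :: "('n::finite) apt_point set" where
  "Lambda_bar = (\<Union>I\<in>{I. I \<noteq> {}}. Lambda_face I)"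

definition restr :: "('n::finite) set \<Rightarrow> 'n apt_point \<Rightarrow> 'n apt_point" where
  "restr J z = (J, {y. \<exists>x\<in>snd z. \<forall>i\<in>J. y $ i = x $ i})"

definition root_val :: "('n::finite) \<Rightarrow> 'n \<Rightarrow> 'n apt_point \<Rightarrow> real" where
  "root_val i j z = (THE a. \<exists>x. z = pt UNIV x \<and> a = x $ i - x $ j)"

lemma restr_pt: "restr J (pt UNIV x) = pt J x"
proof -
  have "(\<exists>z. (\<exists>c. \<forall>i. z $ i = x $ i + c) \<and> (\<forall>i\<in>J. y $ i = z $ i)) \<longleftrightarrow>
        (\<exists>c. \<forall>i\<in>J. y $ i = x $ i + c)" for y
  proof
    assume "\<exists>c. \<forall>i\<in>J. y $ i = x $ i + c"
    then obtain c where "\<forall>i\<in>J. y $ i = x $ i + c" ..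
    then show "\<exists>z. (\<exists>c. \<forall>i. z $ i = x $ i + c) \<and> (\<forall>i\<in>J. y $ i = z $ i)"
      by (intro exI[of _ "\<chi> i. x $ i + c"]) auto
  qed auto
  then show ?thesis
    by (simp add: restr_def pt_def)
qed

lemma root_val_pt: "root_val i j (pt UNIV x) = x $ i - x $ j"
  unfolding root_val_def by (rule the_equality) (blast, auto simp: pt_eq_iff)

text \<open>The topology and the bounded sets of the real vector space \<open>Lambda\<close> are those of the quotient.\<close>

definition Lambda_open :: "('n::finite) apt_point set \<Rightarrow> bool" where
  "Lambda_open U \<longleftrightarrow> U \<subseteq> Lambda \<and> open {x. pt UNIV x \<in> U}"

definition Lambda_bounded :: "('n::finite) apt_point set \<Rightarrow> bool" where
  "Lambda_bounded U \<longleftrightarrow> (\<exists>B. bounded B \<and> U \<subseteq> pt UNIV ` B)"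

definition cone :: "('n::finite) set \<Rightarrow> 'n apt_point set" where
  "cone I = {pt UNIV d | d. (\<forall>i\<in>I. d $ i = 0) \<and> (\<forall>i. i \<notin> I \<longrightarrow> d $ i \<le> 0)}"

definition Lambda_sum :: "('n::finite) apt_point set \<Rightarrow> 'n apt_point set \<Rightarrow> 'n apt_point set" where
  "Lambda_sum U D = {pt UNIV (x + d) | x d. pt UNIV x \<in> U \<and> pt UNIV d \<in> D}"

definition corner :: "('n::finite) set \<Rightarrow> 'n apt_point set \<Rightarrow> 'n apt_point set" where
  "corner I U = Lambda_sum U (cone I) \<union>
     (\<Union>J\<in>{J. I \<subseteq> J \<and> J \<noteq> UNIV}. restr J ` Lambda_sum U (cone I))"

text \<open>
  The displayed sets are a base, so generating a topology from them as a subbase, as the library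
  does, gives the topology in which exactly their unions are open.
\<close>

definition Lambda_bar_topology :: "('n::finite) apt_point topology" where
  "Lambda_bar_topology = topology_generated_by
     ({U. Lambda_open U} \<union>
      {corner I U | I U. I \<noteq> {} \<and> I \<noteq> UNIV \<and> Lambda_open U \<and> Lambda_bounded U})"

text \<open>
  The vector whose coordinate at w i is x_i, for all i, is the image of x under w; so the image of
  a coset consists of the y such that the vector with coordinates y_(w i) lies in the coset.
\<close>

definition perm_act :: "(('n::finite) \<Rightarrow> 'n) \<Rightarrow> 'n apt_point \<Rightarrow> 'n apt_point" where
  "perm_act w z = (w ` fst z, {y. (\<chi> i. y $ w i) \<in> snd z})"

definition torus_act :: "('k::field \<Rightarrow> ereal) \<Rightarrow> 'k ^ ('n::finite) \<Rightarrow> 'n apt_point \<Rightarrow> 'n apt_point" where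
  "torus_act v t z = (fst z, (\<lambda>x. \<chi> i. x $ i - real_of_ereal (v (t $ i))) ` snd z)"

lemma perm_act_pt:
  assumes "bij w"
  shows "perm_act w (pt I x) = pt (w ` I) (\<chi> i. x $ inv_into UNIV w i)"
  using assms by (simp add: perm_act_def pt_def bij_is_inj)

lemma torus_act_pt:
  fixes x :: "real ^ 'n"
  shows "torus_act v t (pt I x) = pt I (\<chi> i. x $ i - real_of_ereal (v (t $ i)))"
proof -
  let ?a = "\<lambda>i. real_of_ereal (v (t $ i))"
  let ?f = "\<lambda>y. (\<chi> i. y $ i - ?a i) :: real ^ 'n"
  let ?L = "{y. \<exists>c. \<forall>i\<in>I. y $ i = x $ i + c}"
  let ?R = "{y. \<exists>c. \<forall>i\<in>I. y $ i = ?f x $ i + c}"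
  have "?f ` ?L = ?R"
  proof (rule subset_antisym)
    show "?f ` ?L \<subseteq> ?R"
    proof
      fix z assume "z \<in> ?f ` ?L"
      then obtain y c where "\<forall>i\<in>I. y $ i = x $ i + c" and "z = ?f y"
        by blast
      then have "\<forall>i\<in>I. z $ i = ?f x $ i + c" by simp
      then show "z \<in> ?R" by blast
    qed
    show "?R \<subseteq> ?f ` ?L"
    proof
      fix z assume "z \<in> ?R"
      then obtain c where c: "\<forall>i\<in>I. z $ i = ?f x $ i + c" by blast
      have "z = ?f (\<chi> i. z $ i + ?a i)" by (simp add: vec_eq_iff)
      moreover have "\<forall>i\<in>I. (\<chi> i. z $ i + ?a i) $ i = x $ i + c" using c by simp
      ultimately show "z \<in> ?f ` ?L" by blast
    qed
  qed
  then show ?thesis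
    by (simp only: torus_act_def pt_def fst_conv snd_conv)
qed

text \<open>
  The action of an element of the normalizer, all of which are images of monomial matrices; the
  result does not depend on the monomial matrix chosen (\<open>nu_proj\<close> below).
\<close>

definition nu :: "('k::field \<Rightarrow> ereal) \<Rightarrow> ('k ^ ('n::finite) ^ 'n) set \<Rightarrow> 'n apt_point \<Rightarrow> 'n apt_point" where
  "nu v g z = (THE z'. \<exists>t w. (\<forall>i. t $ i \<noteq> 0) \<and> bij w \<and>
     g = proj (diag_mat t ** perm_mat w) \<and> z' = torus_act v t (perm_act w z))"

lemma nu_proj:
  fixes v :: "'k::field \<Rightarrow> ereal" and t :: "'k ^ 'n"
  assumes v: "normalized_valuation v" and t: "\<forall>i. t $ i \<noteq> 0" and w: "bij w"
  shows "nu v (proj (diag_mat t ** perm_mat w)) (pt I x) = torus_act v t (perm_act w (pt I x))"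
  unfolding nu_def
proof (rule the_equality)
  show "\<exists>t' w'. (\<forall>i. t' $ i \<noteq> 0) \<and> bij w' \<and>
      proj (diag_mat t ** perm_mat w) = proj (diag_mat t' ** perm_mat w') \<and>
      torus_act v t (perm_act w (pt I x)) = torus_act v t' (perm_act w' (pt I x))"
    using t w by blast
next
  fix z
  assume "\<exists>t' w'. (\<forall>i. t' $ i \<noteq> 0) \<and> bij w' \<and>
      proj (diag_mat t ** perm_mat w) = proj (diag_mat t' ** perm_mat w') \<and>
      z = torus_act v t' (perm_act w' (pt I x))"
  then obtain t' w' where t': "\<forall>i. t' $ i \<noteq> 0" and w': "bij w'"
    and eq: "proj (diag_mat t ** perm_mat w) = proj (diag_mat t' ** perm_mat w')"
    and z: "z = torus_act v t' (perm_act w' (pt I x))" by blast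
  have monomial: "(diag_mat s ** perm_mat u) $ i $ j = (if i = u j then s $ i else 0)"
    for s :: "'k ^ 'n" and u i j
    by (simp add: matrix_matrix_mult_def diag_mat_def perm_mat_def if_distrib[of "\<lambda>a. a * _"]
        cong: if_cong)
  have scalar: "(mat c ** A) $ i $ j = c * A $ i $ j" for c and A :: "'k ^ 'n ^ 'n" and i j
    by (simp add: matrix_matrix_mult_def mat_def if_distrib[of "\<lambda>a. a * _"] cong: if_cong)
  have proj: "proj A = (\<lambda>c. mat c ** A) ` (- {0})" for A :: "'k ^ 'n ^ 'n"
    unfolding proj_def r_coset_def scalars_def GL_def monoid.simps by blast
  have "mat 1 ** (diag_mat t' ** perm_mat w') \<in> proj (diag_mat t' ** perm_mat w')"
    unfolding proj by (rule imageI) simp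
  then have "mat 1 ** (diag_mat t' ** perm_mat w') \<in>
      (\<lambda>c. mat c ** (diag_mat t ** perm_mat w)) ` (- {0})"
    unfolding eq[symmetric] unfolding proj .
  then obtain c where "c \<in> - {0}"
    and M: "mat 1 ** (diag_mat t' ** perm_mat w') = mat c ** (diag_mat t ** perm_mat w)"
    by (rule imageE)
  then have c: "c \<noteq> 0" by simp
  have entry: "(if i = w' j then t' $ i else 0) = c * (if i = w j then t $ i else 0)" for i j
    using arg_cong[OF M, of "\<lambda>A. A $ i $ j"] unfolding scalar monomial mult_1_left .
  have "w' j = w j" for j
    using entry[of "w' j" j] t' by (auto split: if_splits)
  then have ww: "w' = w" by auto
  have tt: "t' $ i = c * t $ i" for i
    using entry[of i "inv_into UNIV w i"] w ww by (simp add: bij_is_surj surj_f_inv_f)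
  have fin: "\<exists>r. v a = ereal r" if "a \<noteq> 0" for a
    using v that unfolding normalized_valuation_def by blast
  have "real_of_ereal (v (t' $ i)) = real_of_ereal (v c) + real_of_ereal (v (t $ i))" for i
  proof -
    have "v (t' $ i) = v c + v (t $ i)"
      using v by (simp add: normalized_valuation_def tt)
    then show ?thesis using fin[OF c] fin[of "t $ i"] t by auto
  qed
  then show "z = torus_act v t (perm_act w (pt I x))"
    unfolding z ww perm_act_pt[OF w] torus_act_pt pt_eq_iff
    by (intro conjI refl exI[of _ "real_of_ereal (v c)"]) simp
qed


section \<open>The groups attached to a point\<close>

text \<open>
  A root a_ij is given by its pair of indices.  In the root group of a_ij the filtration value of the
  image of \<open>elem_mat i j \<omega>\<close> is \<open>v \<omega>\<close>.
\<close>

definition f_at :: "('n::finite) apt_point \<Rightarrow> 'n \<Rightarrow> 'n \<Rightarrow> ereal" where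
  "f_at x i j = Inf (ereal ` {t. x \<in> Lambda_bar_topology closure_of {z \<in> Lambda. - t \<le> root_val i j z}})"

definition root_group_at ::
    "('k::field \<Rightarrow> ereal) \<Rightarrow> ('n::finite) apt_point \<Rightarrow> 'n \<Rightarrow> 'n \<Rightarrow> ('k ^ 'n ^ 'n) set set" where
  "root_group_at v x i j = {proj (elem_mat i j \<omega>) | \<omega>. f_at x i j \<le> v \<omega>}"

definition U_at :: "('k::field \<Rightarrow> ereal) \<Rightarrow> ('n::finite) apt_point \<Rightarrow> ('k ^ 'n ^ 'n) set set" where
  "U_at v x = generate PGL (\<Union>(i, j)\<in>{(i, j). i \<noteq> j}. root_group_at v x i j)"

definition N_at :: "('k::field \<Rightarrow> ereal) \<Rightarrow> ('n::finite) apt_point \<Rightarrow> ('k ^ 'n ^ 'n) set set" where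
  "N_at v x = {g \<in> torus_normalizer. nu v g x = x}"

definition P_at :: "('k::field \<Rightarrow> ereal) \<Rightarrow> ('n::finite) apt_point \<Rightarrow> ('k ^ 'n ^ 'n) set set" where
  "P_at v x = U_at v x <#>\<^bsub>PGL\<^esub> N_at v x"

end

theory Submission
  imports Defs
begin

text \<open>
  Since \<open>N_x\<close> and \<open>N_y\<close> lie in \<open>N\<close>, it suffices to bring every matrix \<open>g\<close> to monomial form by row
  operations from \<open>U_x\<close> and column operations from \<open>U_y\<close>.  Let \<open>x\<close> lie in the face of \<open>I\<close>, with
  coordinates \<open>x_i\<close>.  For \<open>i, k \<in> I\<close> a multiple \<open>\<omega>\<close> of row \<open>k\<close> may be added to row \<open>i\<close> if
  \<open>v \<omega> \<ge> x_k - x_i\<close>, for \<open>k \<notin> I\<close> there is no restriction, and likewise for the columns and \<open>y\<close>.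
  Hence an entry \<open>g_kl\<close> for which \<open>v g_kl + x_k - y_l\<close> is minimal clears its column and its row,
  provided the rows outside \<open>I\<close> are treated before the others.
\<close>

section \<open>The projective linear group\<close>

lemma group_GL: "group (GL :: ('k::field ^ 'n ^ 'n) monoid)"
proof (rule groupI)
  fix A :: "'k ^ 'n ^ 'n"
  assume "A \<in> carrier GL"
  then show "\<exists>B\<in>carrier GL. B \<otimes>\<^bsub>GL\<^esub> A = \<one>\<^bsub>GL\<^esub>"
    unfolding GL_def by (auto simp: invertible_def)
next
  show "\<one>\<^bsub>GL\<^esub> \<in> carrier (GL :: ('k ^ 'n ^ 'n) monoid)"
    by (auto simp: GL_def invertible_def intro: exI[of _ "mat 1"])
qed (simp_all add: GL_def invertible_mult matrix_mul_assoc)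

lemma mat_mult: "mat c ** mat d = (mat (c * d) :: 'k::field ^ 'n ^ 'n)"
  by (simp add: vec_eq_iff matrix_matrix_mult_def mat_def if_distrib[of "\<lambda>a. a * _"] cong: if_cong)

lemma mat_mult_commute: "mat c ** A = A ** (mat c :: 'k::field ^ 'n ^ 'n)"
  by (simp add: vec_eq_iff matrix_matrix_mult_def mat_def if_distrib[of "\<lambda>a. a * _"]
      if_distrib[of "\<lambda>a. _ * a"] mult.commute cong: if_cong)

lemma invertible_mat: "c \<noteq> 0 \<Longrightarrow> invertible (mat c :: 'k::field ^ 'n ^ 'n)"
  unfolding invertible_def by (rule exI[of _ "mat (inverse c)"]) (simp add: mat_mult)

text \<open>Scalar matrices are central, so left and right cosets agree.\<close>

lemma normal_scalars: "(scalars :: ('k::field ^ 'n ^ 'n) set) \<lhd> GL"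
proof -
  interpret group "GL :: ('k ^ 'n ^ 'n) monoid" by (rule group_GL)
  have "subgroup (scalars :: ('k ^ 'n ^ 'n) set) GL"
  proof (rule subgroupI)
    show "scalars \<subseteq> carrier (GL :: ('k ^ 'n ^ 'n) monoid)"
      by (auto simp: scalars_def GL_def invertible_mat)
    show "scalars \<noteq> ({} :: ('k ^ 'n ^ 'n) set)"
      unfolding scalars_def by (auto intro!: exI[of _ 1])
  next
    fix A :: "'k ^ 'n ^ 'n"
    assume "A \<in> scalars"
    then obtain c where c: "A = mat c" "c \<noteq> 0" unfolding scalars_def by blast
    have "inv\<^bsub>GL\<^esub> A = mat (inverse c)"
      using c by (intro inv_equality) (auto simp: GL_def mat_mult invertible_mat)
    then show "inv\<^bsub>GL\<^esub> A \<in> scalars" using c by (auto simp: scalars_def)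
  next
    fix A B :: "'k ^ 'n ^ 'n"
    assume "A \<in> scalars" "B \<in> scalars"
    then show "A \<otimes>\<^bsub>GL\<^esub> B \<in> scalars"
      by (force simp: scalars_def GL_def mat_mult)
  qed
  moreover have "scalars #>\<^bsub>GL\<^esub> A = A <#\<^bsub>GL\<^esub> scalars" for A :: "'k ^ 'n ^ 'n"
  proof -
    have "h ** A = A ** h" if "h \<in> scalars" for h
      using that by (auto simp: scalars_def intro: mat_mult_commute)
    then show ?thesis unfolding r_coset_def l_coset_def GL_def monoid.simps by simp
  qed
  ultimately show ?thesis by (auto intro: normalI)
qed

lemma group_PGL: "group (PGL :: ('k::field ^ 'n ^ 'n) set monoid)"
  unfolding PGL_def by (rule normal.factorgroup_is_group[OF normal_scalars])

lemma carrier_PGL: "carrier (PGL :: ('k::field ^ 'n ^ 'n) set monoid) = proj ` {A. invertible A}"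
  by (auto simp: PGL_def FactGroup_def RCOSETS_def proj_def GL_def)

lemma proj_in_PGL: "invertible A \<Longrightarrow> proj A \<in> carrier PGL"
  by (simp add: carrier_PGL)

lemma proj_mult:
  "invertible A \<Longrightarrow> invertible B \<Longrightarrow> proj A \<otimes>\<^bsub>PGL\<^esub> proj B = proj (A ** B)"
  using normal.rcos_sum[OF normal_scalars, of A B]
  by (simp add: PGL_def FactGroup_def proj_def) (simp add: GL_def)

lemma proj_one: "proj (mat 1 :: 'k::field ^ 'n ^ 'n) = \<one>\<^bsub>PGL\<^esub>"
proof -
  interpret group "PGL :: ('k ^ 'n ^ 'n) set monoid" by (rule group_PGL)
  have "invertible (mat 1 :: 'k ^ 'n ^ 'n)" by (simp add: invertible_mat)
  then show ?thesis
    by (metis matrix_mul_lid proj_in_PGL proj_mult r_cancel_one)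
qed

section \<open>Monomial matrices\<close>

lemma monomial_nth:
  fixes t :: "'k::field ^ 'n"
  shows "(diag_mat t ** perm_mat w) $ i $ j = (if i = w j then t $ i else 0)"
  by (simp add: matrix_matrix_mult_def diag_mat_def perm_mat_def if_distrib[of "\<lambda>a. a * _"]
      cong: if_cong)

lemma perm_mat_id: "perm_mat (\<lambda>i. i) = mat 1"
  by (simp add: vec_eq_iff perm_mat_def mat_def)

lemma diag_mat_one: "diag_mat (\<chi> i. 1) = mat 1"
  by (simp add: vec_eq_iff diag_mat_def mat_def)

lemma invertible_diag_mat:
  fixes t :: "'k::field ^ 'n"
  assumes "\<forall>i. t $ i \<noteq> 0"
  shows "invertible (diag_mat t)"
  unfolding invertible_right_inverse
  using assms
  by (intro exI[of _ "diag_mat (\<chi> i. inverse (t $ i))"])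
    (simp add: vec_eq_iff matrix_matrix_mult_def diag_mat_def mat_def if_distrib[of "\<lambda>a. a * _"]
      cong: if_cong)

lemma invertible_perm_mat:
  fixes w :: "'n::finite \<Rightarrow> 'n"
  assumes "bij w"
  shows "invertible (perm_mat w :: 'k::field ^ 'n ^ 'n)"
  unfolding invertible_left_inverse
  using assms
  by (intro exI[of _ "perm_mat (inv_into UNIV w)"])
    (simp add: vec_eq_iff matrix_matrix_mult_def perm_mat_def mat_def if_distrib[of "\<lambda>a. _ * a"]
      bij_is_inj cong: if_cong)

lemma invertible_monomial:
  fixes t :: "'k::field ^ 'n"
  assumes "\<forall>i. t $ i \<noteq> 0" and "bij w"
  shows "invertible (diag_mat t ** perm_mat w)"
  using assms by (intro invertible_mult invertible_diag_mat invertible_perm_mat)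

lemma torus_subset: "torus \<subseteq> carrier (PGL :: ('k::field ^ 'n ^ 'n) set monoid)"
  by (auto simp: torus_def intro!: proj_in_PGL invertible_diag_mat)

lemma diag_mat_mult_nth: "(diag_mat s ** A) $ i $ j = s $ i * A $ i $ j"
  by (simp add: matrix_matrix_mult_def diag_mat_def if_distrib[of "\<lambda>a. a * _"] cong: if_cong)

lemma mult_diag_mat_nth: "(A ** diag_mat s) $ i $ j = A $ i $ j * s $ j"
  by (simp add: matrix_matrix_mult_def diag_mat_def if_distrib[of "\<lambda>a. _ * a"] cong: if_cong)

text \<open>Conjugation by a monomial matrix only permutes the entries of a diagonal matrix, which
  is why it preserves the torus.\<close>

lemma monomial_diag_commute:
  fixes t s :: "'k::field ^ 'n"
  shows "(diag_mat t ** perm_mat w) ** diag_mat (\<chi> i. s $ w i) =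
    diag_mat s ** (diag_mat t ** perm_mat w)"
  unfolding vec_eq_iff mult_diag_mat_nth diag_mat_mult_nth[of s] monomial_nth by simp

text \<open>Torus elements pass through the monomial matrix with permuted entries, so its left and
  right \<open>torus\<close> cosets agree. This suffices, as the normalizer is the stabilizer of
  \<open>torus\<close> under conjugation.\<close>

lemma monomial_in_normalizer:
  fixes t :: "'k::field ^ 'n"
  assumes t: "\<forall>i. t $ i \<noteq> 0" and w: "bij w"
  shows "proj (diag_mat t ** perm_mat w) \<in> torus_normalizer"
proof -
  interpret group "PGL :: ('k ^ 'n ^ 'n) set monoid" by (rule group_PGL)
  let ?m = "diag_mat t ** perm_mat w"
  note m = invertible_monomial[OF t w]
  have conj: "proj ?m \<otimes>\<^bsub>PGL\<^esub> proj (diag_mat (\<chi> i. s $ w i)) = proj (diag_mat s) \<otimes>\<^bsub>PGL\<^esub> proj ?m"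
    if "\<forall>i. s $ i \<noteq> 0" for s :: "'k ^ 'n"
    using that by (simp add: proj_mult m invertible_diag_mat monomial_diag_commute)
  have "proj ?m <#\<^bsub>PGL\<^esub> torus = torus #>\<^bsub>PGL\<^esub> proj ?m"
  proof (rule subset_antisym; rule subsetI)
    fix z assume "z \<in> proj ?m <#\<^bsub>PGL\<^esub> torus"
    then obtain s where s: "\<forall>i. s $ i \<noteq> 0" and z: "z = proj ?m \<otimes>\<^bsub>PGL\<^esub> proj (diag_mat s)"
      by (auto simp: l_coset_def torus_def)
    \<comment> \<open>Reindexing by the inverse of \<open>w\<close> undoes the permutation of the
      entries in \<open>conj\<close>.\<close>
    let ?s = "\<chi> i. s $ inv_into UNIV w i"
    have "s = (\<chi> i. ?s $ w i)" using w by (simp add: vec_eq_iff bij_is_inj)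
    moreover have s': "\<forall>i. ?s $ i \<noteq> 0" using s by simp
    ultimately have "z = proj (diag_mat ?s) \<otimes>\<^bsub>PGL\<^esub> proj ?m" using z conj[OF s'] by simp
    moreover have "proj (diag_mat ?s) \<in> torus" using s' unfolding torus_def by blast
    ultimately show "z \<in> torus #>\<^bsub>PGL\<^esub> proj ?m" unfolding r_coset_def by blast
  next
    fix z assume "z \<in> torus #>\<^bsub>PGL\<^esub> proj ?m"
    then obtain s where s: "\<forall>i. s $ i \<noteq> 0" and z: "z = proj (diag_mat s) \<otimes>\<^bsub>PGL\<^esub> proj ?m"
      by (auto simp: r_coset_def torus_def)
    let ?s = "\<chi> i. s $ w i"
    have "\<forall>i. ?s $ i \<noteq> 0" using s by simp
    then have "proj (diag_mat ?s) \<in> torus" unfolding torus_def by blast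
    then show "z \<in> proj ?m <#\<^bsub>PGL\<^esub> torus"
      unfolding l_coset_def z conj[OF s, symmetric] by blast
  qed
  then show ?thesis
    using torus_subset[where 'k = 'k and 'n = 'n] proj_in_PGL[OF m]
    by (simp add: torus_normalizer_def normalizer_def stabilizer_def coset_mult_assoc)
qed

lemma torus_normalizer_subset:
  "torus_normalizer \<subseteq> carrier (PGL :: ('k::field ^ 'n ^ 'n) set monoid)"
  by (auto simp: torus_normalizer_def normalizer_def stabilizer_def)

text \<open>This yields that \<open>U_at v x\<close> is contained in
  \<open>P_at v x\<close>.\<close>

lemma one_in_N_at:
  assumes "normalized_valuation v" and "x \<in> Lambda_bar"
  shows "\<one>\<^bsub>PGL\<^esub> \<in> N_at (v :: 'k::field \<Rightarrow> ereal) (x :: 'n::finite apt_point)"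
proof -
  obtain I x0 where x: "x = pt I x0"
    using assms(2) by (auto simp: Lambda_bar_def Lambda_face_def)
  let ?t = "(\<chi> i. 1) :: 'k ^ 'n"
  have t: "\<forall>i. ?t $ i \<noteq> 0" by simp
  have eq: "\<one>\<^bsub>PGL\<^esub> = proj (diag_mat ?t ** perm_mat (\<lambda>i. i))"
    by (simp add: perm_mat_id diag_mat_one proj_one)
  have w: "bij (\<lambda>i::'n. i)" by (simp add: bij_id[unfolded id_def])
  \<comment> \<open>The identity, written as a monomial matrix, translates every coordinate by the
    same amount \<open>v 1\<close>; such a shift is zero in the quotient.\<close>
  have "nu v (\<one>\<^bsub>PGL\<^esub> :: ('k ^ 'n ^ 'n) set) x = x"
    unfolding eq x nu_proj[OF assms(1) t w] perm_act_pt[OF w] torus_act_pt pt_eq_iff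
    by (auto simp: inv_into_def intro!: exI[of _ "real_of_ereal (v 1)"])
  then show ?thesis
    using monomial_in_normalizer[OF t w] unfolding N_at_def eq by simp
qed

section \<open>Elimination\<close>

lemma elem_mat_mult_nth:
  fixes A :: "'k::field ^ 'n ^ 'n"
  assumes "i \<noteq> j"
  shows "(elem_mat i j a ** A) $ r $ s = A $ r $ s + (if r = i then a * A $ j $ s else 0)"
proof -
  \<comment> \<open>Splitting off the diagonal of \<open>elem_mat\<close> leaves two sums with at
    most one nonzero term each.\<close>
  have "(elem_mat i j a ** A) $ r $ s =
      (\<Sum>k\<in>UNIV. (if r = k then A $ k $ s else 0) + (if k = j then if r = i then a * A $ k $ s else 0 else 0))"
    unfolding matrix_matrix_mult_def using assms
    by (auto simp: elem_mat_def intro!: sum.cong)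
  then show ?thesis by (simp add: sum.distrib)
qed

lemma mult_elem_mat_nth:
  fixes A :: "'k::field ^ 'n ^ 'n"
  assumes "i \<noteq> j"
  shows "(A ** elem_mat i j a) $ r $ s = A $ r $ s + (if s = j then a * A $ r $ i else 0)"
proof -
  have "(A ** elem_mat i j a) $ r $ s =
      (\<Sum>k\<in>UNIV. (if k = s then A $ r $ k else 0) + (if k = i then if s = j then a * A $ r $ k else 0 else 0))"
    unfolding matrix_matrix_mult_def using assms
    by (auto simp: elem_mat_def intro!: sum.cong)
  then show ?thesis by (simp add: sum.distrib)
qed

lemma invertible_elem_mat:
  fixes a :: "'k::field"
  assumes "i \<noteq> j"
  shows "invertible (elem_mat i j a)"
proof -
  have "(elem_mat i j a ** elem_mat i j (- a)) $ r $ s = mat 1 $ r $ s" for r s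
    unfolding elem_mat_mult_nth[OF assms] using assms by (simp add: elem_mat_def mat_def)
  then have "elem_mat i j a ** elem_mat i j (- a) = mat 1" by (simp add: vec_eq_iff)
  then show ?thesis unfolding invertible_right_inverse by blast
qed

text \<open>Row \<open>k\<close> lies outside \<open>S\<close> and is never changed, so every
  operation adds a multiple of the original row \<open>k\<close>. The set \<open>L\<close> will be
  the preimage of a group \<open>U_at\<close>.\<close>

lemma clear_column:
  fixes g :: "'k::field ^ 'n ^ 'n"
  assumes "finite S" and "k \<notin> S" and "mat 1 \<in> L" and "\<And>A B. A \<in> L \<Longrightarrow> B \<in> L \<Longrightarrow> A ** B \<in> L"
    and "\<And>i. i \<in> S \<Longrightarrow> elem_mat i k (c i) \<in> L"
  shows "\<exists>A\<in>L. \<forall>r s. (A ** g) $ r $ s = g $ r $ s + (if r \<in> S then c r * g $ k $ s else 0)"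
  using assms(1,2,5)
proof (induction S rule: finite_induct)
  case empty
  show ?case using assms(3) by (intro bexI[of _ "mat 1"]) auto
next
  case (insert i S)
  then obtain A where A: "A \<in> L"
    "\<forall>r s. (A ** g) $ r $ s = g $ r $ s + (if r \<in> S then c r * g $ k $ s else 0)"
    by auto
  have "elem_mat i k (c i) ** A \<in> L" using insert.prems A(1) assms(4) by simp
  moreover have "i \<noteq> k" "k \<notin> S" using insert.prems by auto
  ultimately show ?case using A(2) insert.hyps
    by (intro bexI[of _ "elem_mat i k (c i) ** A"])
      (auto simp: matrix_mul_assoc[symmetric] elem_mat_mult_nth)
qed

text \<open>The counterpart of \<open>clear_column\<close> for columns: operations multiply on the
  right and column \<open>l\<close> stays fixed.\<close>

lemma clear_row:
  fixes g :: "'k::field ^ 'n ^ 'n"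
  assumes "finite S" and "l \<notin> S" and "mat 1 \<in> M" and "\<And>A B. A \<in> M \<Longrightarrow> B \<in> M \<Longrightarrow> A ** B \<in> M"
    and "\<And>j. j \<in> S \<Longrightarrow> elem_mat l j (c j) \<in> M"
  shows "\<exists>B\<in>M. \<forall>r s. (g ** B) $ r $ s = g $ r $ s + (if s \<in> S then c s * g $ r $ l else 0)"
  using assms(1,2,5)
proof (induction S rule: finite_induct)
  case empty
  show ?case using assms(3) by (intro bexI[of _ "mat 1"]) auto
next
  case (insert j S)
  then obtain B where B: "B \<in> M"
    "\<forall>r s. (g ** B) $ r $ s = g $ r $ s + (if s \<in> S then c s * g $ r $ l else 0)"
    by auto
  have "B ** elem_mat l j (c j) \<in> M" using insert.prems B(1) assms(4) by simp
  moreover have "l \<noteq> j" "l \<notin> S" using insert.prems by auto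
  ultimately show ?case using B(2) insert.hyps
    by (intro bexI[of _ "B ** elem_mat l j (c j)"])
      (auto simp: matrix_mul_assoc mult_elem_mat_nth)
qed

lemma invertible_row_nonzero:
  fixes A :: "'k::field ^ 'n ^ 'n"
  assumes "invertible A"
  shows "\<exists>j. A $ i $ j \<noteq> 0"
proof (rule ccontr)
  assume "\<not> ?thesis"
  moreover obtain B where "A ** B = mat 1" using assms by (auto simp: invertible_def)
  then have "(A ** B) $ i $ i = 1" by (simp add: mat_def)
  ultimately show False by (simp add: matrix_matrix_mult_def)
qed

lemma invertible_column_nonzero:
  fixes A :: "'k::field ^ 'n ^ 'n"
  assumes "invertible A"
  shows "\<exists>i. A $ i $ j \<noteq> 0"
proof (rule ccontr)
  assume "\<not> ?thesis"
  moreover obtain B where "B ** A = mat 1" using assms by (auto simp: invertible_def)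
  then have "(B ** A) $ j $ j = 1" by (simp add: mat_def)
  ultimately show False by (simp add: matrix_matrix_mult_def)
qed

text \<open>
  \<open>R\<close> and \<open>C\<close> are the rows and columns still to be treated; outside \<open>R \<times> C\<close> the matrix is already
  monomial, its nonzero entries being at the places \<open>(w j, j)\<close>.
\<close>

lemma elimination:
  fixes g :: "'k::field ^ 'n ^ 'n"
  assumes L: "mat 1 \<in> L" "\<And>A B. A \<in> L \<Longrightarrow> B \<in> L \<Longrightarrow> A ** B \<in> L" "\<And>A. A \<in> L \<Longrightarrow> invertible A"
    and M: "mat 1 \<in> M" "\<And>A B. A \<in> M \<Longrightarrow> B \<in> M \<Longrightarrow> A ** B \<in> M" "\<And>A. A \<in> M \<Longrightarrow> invertible A"
    and pivot: "\<And>(g :: 'k ^ 'n ^ 'n) R C. R \<noteq> {} \<Longrightarrow> \<forall>k\<in>R. \<exists>l\<in>C. g $ k $ l \<noteq> 0 \<Longrightarrow>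
      \<exists>k\<in>R. \<exists>l\<in>C. g $ k $ l \<noteq> 0 \<and>
        (\<forall>i\<in>R - {k}. elem_mat i k (- (g $ i $ l / g $ k $ l)) \<in> L) \<and>
        (\<forall>j\<in>C - {l}. elem_mat l j (- (g $ k $ j / g $ k $ l)) \<in> M)"
    and "invertible g" and "bij_betw w (- C) (- R)"
    and "\<forall>i j. g $ i $ j \<noteq> 0 \<longrightarrow> i \<in> R \<and> j \<in> C \<or> j \<notin> C \<and> i = w j"
  shows "\<exists>A\<in>L. \<exists>B\<in>M. \<exists>w. bij w \<and> (\<forall>i j. (A ** g ** B) $ i $ j \<noteq> 0 \<longrightarrow> i = w j)"
proof -
  show ?thesis using assms(8-10)
  proof (induction "card R" arbitrary: R C w g)
    case 0
    then have "R = {}" by simp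
    \<comment> \<open>With no rows left, the bijection \<open>w\<close> forces that no columns are
      left either.\<close>
    have "card (- C) = card (- R)" using 0 bij_betw_same_card by blast
    then have "- C = UNIV" using \<open>R = {}\<close> by (simp add: card_eq_UNIV_imp_eq_UNIV)
    with 0 \<open>R = {}\<close> have "bij w" "\<forall>i j. (mat 1 ** g ** mat 1) $ i $ j \<noteq> 0 \<longrightarrow> i = w j" by auto
    then show ?case using L(1) M(1) by blast
  next
    case (Suc n)
    note inv = Suc.prems(1) and bij = Suc.prems(2) and supp = Suc.prems(3)[rule_format]
    \<comment> \<open>A nonzero entry in a column outside \<open>C\<close> sits in a row outside
      \<open>R\<close>, so the nonzero entries of row \<open>k\<close> lie in
      \<open>C\<close>.\<close>
    have "\<exists>l\<in>C. g $ k $ l \<noteq> 0" if k: "k \<in> R" for k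
    proof -
      obtain l where l: "g $ k $ l \<noteq> 0" using invertible_row_nonzero[OF inv] by blast
      have "l \<in> C" using supp[OF l] k bij by (auto simp: bij_betw_def)
      with l show ?thesis by blast
    qed
    moreover have "R \<noteq> {}" using Suc.hyps by auto
    ultimately obtain k l where k: "k \<in> R" and l: "l \<in> C" and p: "g $ k $ l \<noteq> 0"
      and cL: "\<And>i. i \<in> R - {k} \<Longrightarrow> elem_mat i k (- (g $ i $ l / g $ k $ l)) \<in> L"
      and cM: "\<And>j. j \<in> C - {l} \<Longrightarrow> elem_mat l j (- (g $ k $ j / g $ k $ l)) \<in> M"
      using pivot[of R C g] by blast
    obtain A where A: "A \<in> L" and Ag: "\<And>r s. (A ** g) $ r $ s =
        g $ r $ s + (if r \<in> R - {k} then - (g $ r $ l / g $ k $ l) * g $ k $ s else 0)"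
      using clear_column[of "R - {k}" k L "\<lambda>i. - (g $ i $ l / g $ k $ l)" g] L cL by auto
    obtain B where B: "B \<in> M" and AgB: "\<And>r s. (A ** g ** B) $ r $ s = (A ** g) $ r $ s +
        (if s \<in> C - {l} then - (g $ k $ s / g $ k $ l) * (A ** g) $ r $ l else 0)"
      using clear_row[of "C - {l}" l M "\<lambda>j. - (g $ k $ j / g $ k $ l)" "A ** g"] M cM by auto
    let ?h = "A ** g ** B" and ?w = "w(l := k)"
    \<comment> \<open>Rows outside \<open>R\<close> already vanish in column \<open>l\<close>
      because \<open>l\<close> is in \<open>C\<close>; the rows of \<open>R\<close> other than
      \<open>k\<close> have just been cleared.\<close>
    have col: "(A ** g) $ r $ l = (if r = k then g $ k $ l else 0)" for r
      using Ag[of r l] p supp[of r l] l by (auto split: if_splits)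
    \<comment> \<open>Column \<open>l\<close> is now zero outside row \<open>k\<close>, so adding
      multiples of it to other columns changes row \<open>k\<close> only.\<close>
    have h: "?h $ r $ s = (if r = k then if s = l then g $ k $ l else if s \<in> C then 0 else g $ k $ s
        else (A ** g) $ r $ s)" for r s
      using AgB[of r s] Ag[of r s] p by (auto simp: col)
    have "\<forall>i j. ?h $ i $ j \<noteq> 0 \<longrightarrow> i \<in> R - {k} \<and> j \<in> C - {l} \<or> j \<notin> C - {l} \<and> i = ?w j"
    proof (intro allI impI)
      fix i j assume ne: "?h $ i $ j \<noteq> 0"
      have off: "g $ k $ j = 0" if "j \<notin> C" using supp[of k j] that k bij by (auto simp: bij_betw_def)
      show "i \<in> R - {k} \<and> j \<in> C - {l} \<or> j \<notin> C - {l} \<and> i = ?w j"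
      proof (cases "i = k")
        case True
        then show ?thesis using ne h[of i j] off by (auto split: if_splits)
      next
        case False
        then have ne': "(A ** g) $ i $ j \<noteq> 0" using ne h by simp
        then have "j \<noteq> l" using col False by auto
        show ?thesis
        proof (cases "g $ i $ j = 0")
          case True
          \<comment> \<open>A newly created entry comes from adding row \<open>k\<close> to a row of
            \<open>R\<close>, and row \<open>k\<close> vanishes outside the columns in
            \<open>C\<close>.\<close>
          then have "i \<in> R" "g $ k $ j \<noteq> 0" using ne' Ag[of i j] by (auto split: if_splits)
          then show ?thesis using off False \<open>j \<noteq> l\<close> by blast
        next
          case nonzero: False
          show ?thesis using supp[OF nonzero] False \<open>j \<noteq> l\<close> by auto
        qed
      qed
    qed
    moreover have "bij_betw ?w (- (C - {l})) (- (R - {k}))"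
    proof -
      have "bij_betw ?w (- C) (- R)" using bij l by (subst bij_betw_cong[of _ _ w]) auto
      then have "bij_betw ?w (insert l (- C)) (insert k (- R))"
        using notIn_Un_bij_betw[of l "- C" ?w "- R"] k l by simp
      moreover have "insert l (- C) = - (C - {l})" "insert k (- R) = - (R - {k})" using k l by auto
      ultimately show ?thesis by metis
    qed
    moreover have "invertible ?h" using inv A B L M by (simp add: invertible_mult)
    moreover have "n = card (R - {k})" using Suc.hyps(2) k by simp
    ultimately obtain A' B' w' where "A' \<in> L" "B' \<in> M" "bij w'"
      "\<forall>i j. (A' ** ?h ** B') $ i $ j \<noteq> 0 \<longrightarrow> i = w' j"
      using Suc.hyps(1)[of "R - {k}" ?h ?w "C - {l}"] by auto
    moreover have "A' ** ?h ** B' = (A' ** A) ** g ** (B ** B')" by (simp add: matrix_mul_assoc)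
    ultimately show ?case using A B L(2) M(2) by metis
  qed
qed

text \<open>Starting with all rows and columns makes the invariant of \<open>elimination\<close>
  trivial. At the end invertibility forces the one admissible entry of each column to be
  nonzero.\<close>

lemma elimination_monomial:
  fixes g :: "'k::field ^ 'n ^ 'n"
  assumes L: "mat 1 \<in> L" "\<And>A B. A \<in> L \<Longrightarrow> B \<in> L \<Longrightarrow> A ** B \<in> L" "\<And>A. A \<in> L \<Longrightarrow> invertible A"
    and M: "mat 1 \<in> M" "\<And>A B. A \<in> M \<Longrightarrow> B \<in> M \<Longrightarrow> A ** B \<in> M" "\<And>A. A \<in> M \<Longrightarrow> invertible A"
    and pivot: "\<And>(g :: 'k ^ 'n ^ 'n) R C. R \<noteq> {} \<Longrightarrow> \<forall>k\<in>R. \<exists>l\<in>C. g $ k $ l \<noteq> 0 \<Longrightarrow>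
      \<exists>k\<in>R. \<exists>l\<in>C. g $ k $ l \<noteq> 0 \<and>
        (\<forall>i\<in>R - {k}. elem_mat i k (- (g $ i $ l / g $ k $ l)) \<in> L) \<and>
        (\<forall>j\<in>C - {l}. elem_mat l j (- (g $ k $ j / g $ k $ l)) \<in> M)"
    and g: "invertible g"
  shows "\<exists>A\<in>L. \<exists>B\<in>M. \<exists>t w. (\<forall>i. t $ i \<noteq> 0) \<and> bij w \<and> A ** g ** B = diag_mat t ** perm_mat w"
proof -
  have bij: "bij_betw (\<lambda>i. i) (- UNIV) (- UNIV :: 'n set)" by (simp add: bij_betw_def)
  have "\<exists>A\<in>L. \<exists>B\<in>M. \<exists>w. bij w \<and> (\<forall>i j. (A ** g ** B) $ i $ j \<noteq> 0 \<longrightarrow> i = w j)"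
    by (rule elimination[where R = UNIV and C = UNIV and w = "\<lambda>i. i"]; (fact | simp))
  then obtain A B w where A: "A \<in> L" and B: "B \<in> M" and w: "bij w"
    and supp: "\<And>i j. (A ** g ** B) $ i $ j \<noteq> 0 \<Longrightarrow> i = w j"
    by metis
  let ?h = "A ** g ** B"
  have inv: "invertible ?h" using A B L M g by (simp add: invertible_mult)
  have nz: "?h $ w j $ j \<noteq> 0" for j
    using invertible_column_nonzero[OF inv, of j] supp[of _ j] by metis
  \<comment> \<open>The nonzero entry of row \<open>i\<close> stands in the column that
    \<open>w\<close> sends to \<open>i\<close>.\<close>
  let ?t = "\<chi> i. ?h $ i $ inv_into UNIV w i"
  have "?t $ i \<noteq> 0" for i using nz[of "inv_into UNIV w i"] w by (simp add: bij_is_surj surj_f_inv_f)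
  moreover have "?h = diag_mat ?t ** perm_mat w"
    unfolding vec_eq_iff monomial_nth using w supp by (auto simp: bij_is_inj)
  ultimately show ?thesis using A B w by blast
qed

section \<open>Root groups at a point\<close>

lemma pt_cong: "(\<And>i. i \<in> I \<Longrightarrow> x $ i = y $ i) \<Longrightarrow> pt I x = pt I y"
  by (auto simp: pt_eq_iff intro!: exI[of _ 0])

text \<open>Points of \<open>Lambda\<close> are vectors modulo constant vectors, which
  \<open>c\<close> absorbs.\<close>

lemma Lambda_sum_shift:
  assumes "pt UNIV u \<in> U" and "\<forall>i\<in>I. d $ i = 0" and "\<forall>i. i \<notin> I \<longrightarrow> d $ i \<le> 0"
    and "\<And>i. z $ i = u $ i + d $ i + c"
  shows "pt UNIV z \<in> Lambda_sum U (cone I)"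
proof -
  have "pt UNIV z = pt UNIV (u + d)"
    unfolding pt_eq_iff by (auto simp: assms(4) intro!: exI[of _ "- c"])
  then show ?thesis using assms(1-3) unfolding Lambda_sum_def cone_def by blast
qed

text \<open>In \<open>Lambda_sum\<close> the summand \<open>d\<close> is any representative of a
  point of the cone; moving a constant to it restores the sign conditions.\<close>

lemma Lambda_sum_coneE:
  assumes "z \<in> Lambda_sum U (cone I)"
  obtains u d where "z = pt UNIV (u + d)" and "pt UNIV u \<in> U"
    and "\<forall>i\<in>I. d $ i = 0" and "\<forall>i. i \<notin> I \<longrightarrow> d $ i \<le> 0"
proof -
  obtain u d e where z: "z = pt UNIV (u + d)" and u: "pt UNIV u \<in> U" and "pt UNIV d = pt UNIV e"
    and e: "\<forall>i\<in>I. e $ i = 0" "\<forall>i. i \<notin> I \<longrightarrow> e $ i \<le> 0"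
    using assms unfolding Lambda_sum_def cone_def by blast
  then obtain c where c: "\<And>i. e $ i = d $ i + c" by (auto simp: pt_eq_iff)
  have "z = pt UNIV (u + e)" using z c by (auto simp: pt_eq_iff intro!: exI[of _ c])
  then show ?thesis using u e that by blast
qed

text \<open>The preimage in the vector space is the union of the translates of the ball by constant
  vectors.\<close>

lemma Lambda_open_ball: "Lambda_open (pt UNIV ` ball x 1)"
proof -
  have *: "{y. pt UNIV y \<in> pt UNIV ` ball x 1} = (\<Union>c. (\<lambda>z. (\<chi> i. c) + z) ` ball x 1)"
    (is "?L = ?R")
  proof (rule Set.set_eqI)
    fix y
    have "y \<in> ?L \<longleftrightarrow> (\<exists>z\<in>ball x 1. pt UNIV z = pt UNIV y)" by (auto simp: image_iff eq_commute)
    also have "\<dots> \<longleftrightarrow> y \<in> ?R" by (auto simp: pt_eq_iff vec_eq_iff image_iff add.commute)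
    finally show "y \<in> ?L \<longleftrightarrow> y \<in> ?R" .
  qed
  have "open ?R" by (intro open_UN ballI open_translation) simp
  then have "open ?L" unfolding * .
  then show ?thesis by (auto simp: Lambda_open_def Lambda_def Lambda_face_def)
qed

text \<open>A boundary point \<open>pt I x0\<close> is the restriction of \<open>pt UNIV x0\<close>,
  hence lies in the corner over a ball around \<open>x0\<close>.\<close>

lemma Lambda_bar_subset_topspace:
  "Lambda_bar \<subseteq> topspace (Lambda_bar_topology :: ('n::finite) apt_point topology)"
proof
  fix x :: "'n apt_point"
  assume "x \<in> Lambda_bar"
  then obtain I x0 where I: "I \<noteq> {}" and x: "x = pt I x0"
    by (auto simp: Lambda_bar_def Lambda_face_def)
  let ?U = "pt UNIV ` ball x0 1"
  have 0: "pt UNIV x0 \<in> ?U" by simp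
  show "x \<in> topspace Lambda_bar_topology"
  proof (cases "I = UNIV")
    case True
    then show ?thesis
      unfolding Lambda_bar_topology_def topology_generated_by_topspace
      using Lambda_open_ball[of x0] 0 x by blast
  next
    case False
    have "pt UNIV x0 \<in> Lambda_sum ?U (cone I)"
      using Lambda_sum_shift[OF 0, of I 0 x0 0] by simp
    then have "x \<in> corner I ?U"
      using False unfolding corner_def x
      by (auto intro!: bexI[of _ I] image_eqI[of _ _ "pt UNIV x0"] simp: restr_pt)
    moreover have "Lambda_bounded ?U" unfolding Lambda_bounded_def by (blast intro: bounded_ball)
    ultimately show ?thesis
      unfolding Lambda_bar_topology_def topology_generated_by_topspace
      using Lambda_open_ball[of x0] False I by blast
  qed
qed

text \<open>
  The point \<open>pt I x\<close> is the limit of points of \<open>Lambda\<close> whose coordinates outside \<open>I\<close> tend to \<open>-\<infinity>\<close>.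
\<close>

lemma eventually_in_open:
  assumes "openin Lambda_bar_topology T" and "pt I x \<in> T"
  shows "\<forall>\<^sub>F m in sequentially. pt UNIV (\<chi> i. if i \<in> I then x $ i else x $ i - real m) \<in> T"
proof -
  let ?z = "\<lambda>m. (\<chi> i. if i \<in> I then x $ i else x $ i - real m) :: real ^ 'a"
  have UNIV: "pt I x = pt UNIV (?z m)" if "I = UNIV" for m
    using that by (auto intro: pt_cong)
  show ?thesis
    using openin_topology_generated_by[OF assms(1)[unfolded Lambda_bar_topology_def]] assms(2)
  proof (induction rule: generate_topology_on.induct[consumes 1])
    case (Basis T)
    show ?case
    proof (cases "I = UNIV")
      case True
      then show ?thesis using Basis UNIV by simp
    next
      case False
      then have ne: "pt I x \<notin> Lambda" by (auto simp: Lambda_def Lambda_face_def pt_eq_iff)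
      then have "\<not> Lambda_open T" using Basis by (auto simp: Lambda_open_def)
      \<comment> \<open>A point of a proper face is not in \<open>Lambda\<close>, so a basic set
        containing it is a corner, and it lies in the boundary part of that corner.\<close>
      then obtain K U where T: "T = corner K U" using Basis by blast
      have "pt I x \<notin> Lambda_sum U (cone K)"
        using ne by (auto simp: Lambda_sum_def Lambda_def Lambda_face_def)
      then obtain J q where J: "K \<subseteq> J" and q: "q \<in> Lambda_sum U (cone K)" and "pt I x = restr J q"
        using Basis(2) unfolding T corner_def by blast
      moreover obtain u d where q': "q = pt UNIV (u + d)" and u: "pt UNIV u \<in> U"
        and d: "\<forall>i\<in>K. d $ i = 0" "\<forall>i. i \<notin> K \<longrightarrow> d $ i \<le> 0"
        using q by (rule Lambda_sum_coneE)
      ultimately have "pt I x = pt J (u + d)" by (simp add: restr_pt)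
      then obtain c where KI: "K \<subseteq> I" and c: "\<And>i. i \<in> I \<Longrightarrow> u $ i + d $ i = x $ i + c"
        using J by (auto simp: pt_eq_iff)
      have "\<forall>\<^sub>F m in sequentially. \<forall>i\<in>UNIV. x $ i + c - u $ i \<le> real m"
        using filterlim_real_sequentially
        by (intro eventually_ball_finite ballI) (auto simp: filterlim_at_top)
      then show ?thesis
      proof (rule eventually_mono)
        fix m :: nat
        \<comment> \<open>Outside \<open>I\<close> the vector is solved from
          \<open>?z m = u + ?d - c\<close>; the bound on \<open>m\<close> makes it nonpositive
          there. On \<open>I\<close> the old \<open>d\<close> works, and \<open>K\<close> is
          contained in \<open>I\<close>.\<close>
        let ?d = "\<chi> i. if i \<in> I then d $ i else x $ i - real m + c - u $ i"
        assume m: "\<forall>i\<in>UNIV. x $ i + c - u $ i \<le> real m"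
        have "pt UNIV (?z m) \<in> Lambda_sum U (cone K)"
        proof (rule Lambda_sum_shift[OF u, of _ ?d _ "- c"])
          show "?z m $ i = u $ i + ?d $ i + - c" for i
            using c[of i] by simp
        qed (use KI d m in \<open>auto simp: algebra_simps\<close>)
        then show "pt UNIV (?z m) \<in> T" unfolding T corner_def by blast
      qed
    qed
  next
    case (Int a b)
    then show ?case by (simp add: eventually_conj)
  next
    case (UN K)
    then obtain k where k: "k \<in> K" "pt I x \<in> k" by blast
    show ?case by (rule eventually_mono[OF UN(2)[OF k]]) (use k in blast)
  qed simp
qed

text \<open>Along the approximating sequence the root value is constant if \<open>i\<close> and
  \<open>j\<close> are both in \<open>I\<close> or both outside, and it grows if only
  \<open>i\<close> is in \<open>I\<close>. The last hypothesis excludes the remaining case, where it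
  would decrease.\<close>

lemma pt_in_closure:
  assumes "I \<noteq> {}" and "- t \<le> x $ i - x $ j" and "j \<in> I \<Longrightarrow> i \<in> I"
  shows "pt I x \<in> Lambda_bar_topology closure_of {z \<in> Lambda. - t \<le> root_val i j z}"
  unfolding in_closure_of
proof (intro conjI allI impI)
  have "pt I x \<in> Lambda_bar" using assms(1) by (auto simp: Lambda_bar_def Lambda_face_def)
  then show "pt I x \<in> topspace Lambda_bar_topology" using Lambda_bar_subset_topspace by blast
next
  fix T assume "pt I x \<in> T \<and> openin Lambda_bar_topology T"
  then obtain m :: nat where "pt UNIV (\<chi> i. if i \<in> I then x $ i else x $ i - real m) \<in> T" (is "pt UNIV ?z \<in> T")
    using eventually_in_open eventually_happens'[OF sequentially_bot] by blast
  moreover have "- t \<le> root_val i j (pt UNIV ?z)"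
    using assms(2,3) by (auto simp: root_val_pt)
  ultimately show "\<exists>y. y \<in> {z \<in> Lambda. - t \<le> root_val i j z} \<and> y \<in> T"
    by (auto simp: Lambda_def Lambda_face_def)
qed

text \<open>An upper bound is what membership in \<open>root_group_at\<close> calls for. If
  \<open>j\<close> is outside \<open>I\<close>, every real \<open>t\<close> is a bound, so the whole
  root group is available.\<close>

lemma f_at_le:
  assumes "I \<noteq> {}" and "i \<noteq> j" and "j \<in> I \<Longrightarrow> i \<in> I \<and> x $ j - x $ i \<le> t"
  shows "f_at (pt I x) i j \<le> ereal t"
proof -
  \<comment> \<open>A coordinate outside \<open>I\<close> does not affect the point and can be chosen freely.\<close>
  define x' where "x' = (if j \<in> I then x else (\<chi> k. if k = j then x $ i + t else x $ k))"
  have "pt I x = pt I x'" unfolding x'_def by (auto intro: pt_cong)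
  moreover have "pt I x' \<in> Lambda_bar_topology closure_of {z \<in> Lambda. - t \<le> root_val i j z}"
    using assms by (intro pt_in_closure) (auto simp: x'_def)
  ultimately show ?thesis unfolding f_at_def by (auto intro: Inf_lower)
qed

lemma U_at_subset: "U_at v x \<subseteq> carrier (PGL :: ('k::field ^ 'n::finite ^ 'n) set monoid)"
  unfolding U_at_def
  by (rule group.generate_incl[OF group_PGL])
    (auto simp: root_group_at_def intro!: proj_in_PGL invertible_elem_mat)

lemma subgroup_U_at: "subgroup (U_at v x) (PGL :: ('k::field ^ 'n::finite ^ 'n) set monoid)"
  unfolding U_at_def
  by (rule group.generate_is_subgroup[OF group_PGL])
    (auto simp: root_group_at_def intro!: proj_in_PGL invertible_elem_mat)

lemma elem_mat_in_U_at:
  assumes "I \<noteq> {}" and "i \<noteq> j" and "v \<omega> \<noteq> - \<infinity>"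
    and "j \<in> I \<Longrightarrow> i \<in> I \<and> ereal (x $ j - x $ i) \<le> v \<omega>"
  shows "proj (elem_mat i j \<omega>) \<in> U_at v (pt I x)"
proof -
  \<comment> \<open>\<open>f_at_le\<close> takes a real bound, whereas \<open>v \<omega>\<close> may
    be infinite; so a real number below it is chosen.\<close>
  have "\<exists>t. ereal t \<le> v \<omega> \<and> (j \<in> I \<longrightarrow> x $ j - x $ i \<le> t)"
    using assms(3,4) by (cases "v \<omega>") auto
  then obtain t where "ereal t \<le> v \<omega>" "j \<in> I \<longrightarrow> x $ j - x $ i \<le> t" by blast
  with f_at_le[of I i j x t] assms have "f_at (pt I x) i j \<le> v \<omega>" by (auto intro: order_trans)
  then show ?thesis
    unfolding U_at_def using assms(2) by (intro generate.incl) (auto simp: root_group_at_def)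
qed

section \<open>The decomposition\<close>

lemma normalized_valuation_quotient:
  assumes "normalized_valuation v" and "b \<noteq> 0"
  shows "v (- (a / b)) = v a - v b" and "\<exists>r. v b = ereal r" and "v a \<noteq> - \<infinity>"
proof -
  have fin: "\<exists>r. v b = ereal r" if "b \<noteq> 0" for b
    using assms that unfolding normalized_valuation_def by blast
  have mult: "v (a * b) = v a + v b" for a b using assms unfolding normalized_valuation_def by blast
  have 0: "v 0 = \<infinity>" using assms unfolding normalized_valuation_def by blast
  obtain r where r: "v b = ereal r" using fin assms(2) by blast
  obtain s where s: "v (- 1) = ereal s" using fin[of "- 1"] by auto
  obtain u where u: "v 1 = ereal u" using fin[of 1] by auto
  \<comment> \<open>Multiplicativity at \<open>1 * 1\<close> and \<open>(- 1) * (- 1)\<close> gives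
    valuation zero to \<open>1\<close> and \<open>- 1\<close>, so the sign in the quotient is
    harmless.\<close>
  have "u = 0" using mult[of 1 1] u by simp
  then have "s = 0" using mult[of "- 1" "- 1"] u s by simp
  then have "v a = v (- (a / b)) + v b"
    using mult[of "- 1" "(- (a / b)) * b"] mult[of "- (a / b)" b] assms(2) s by simp
  then show "v (- (a / b)) = v a - v b" using r by (cases "v (- (a / b))") auto
  show "\<exists>r. v b = ereal r" using r by blast
  show "v a \<noteq> - \<infinity>" using fin[of a] 0 by (cases "a = 0") auto
qed

text \<open>Minimality of \<open>val\<close> compared within column \<open>l\<close> bounds the row
  multipliers by differences of \<open>x\<close>; compared within row \<open>k\<close> it bounds the
  column multipliers by differences of \<open>y\<close>.\<close>

lemma pivot_exists:
  fixes g :: "'k::field ^ 'n ^ 'n" and v :: "'k \<Rightarrow> ereal"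
  assumes v: "normalized_valuation v" and I: "I \<noteq> {}" and "R \<noteq> {}"
    and nz: "\<forall>k\<in>R. \<exists>l\<in>C. g $ k $ l \<noteq> 0"
  shows "\<exists>k\<in>R. \<exists>l\<in>C. g $ k $ l \<noteq> 0 \<and>
    (\<forall>i\<in>R - {k}. proj (elem_mat i k (- (g $ i $ l / g $ k $ l))) \<in> U_at v (pt I x)) \<and>
    (\<forall>j\<in>C - {l}. proj (elem_mat l j (- (g $ k $ j / g $ k $ l))) \<in> U_at v (pt UNIV y))"
proof -
  \<comment> \<open>A row outside \<open>I\<close> may be added to any row without restriction, a
    row in \<open>I\<close> only to rows in \<open>I\<close>. So the pivot row is taken outside
    \<open>I\<close> as long as such rows remain.\<close>
  define R' where "R' = (if R \<subseteq> I then R else R - I)"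
  define S where "S = {(k, l). k \<in> R' \<and> l \<in> C \<and> g $ k $ l \<noteq> 0}"
  define val where "val = (\<lambda>(k, l). real_of_ereal (v (g $ k $ l)) + x $ k - y $ l)"
  have R': "R' \<noteq> {}" "R' \<subseteq> R" using assms(3) by (auto simp: R'_def)
  then have "S \<noteq> {}" using nz by (auto simp: S_def)
  moreover have "finite S" by (rule finite_subset[of _ UNIV]) auto
  ultimately obtain q where q: "q \<in> S" "\<And>q'. q' \<in> S \<Longrightarrow> val q \<le> val q'"
    using ex_min_if_finite[of "val ` S"] by (force simp: not_less)
  obtain k l where kl: "q = (k, l)" by fastforce
  have k: "k \<in> R'" "k \<in> R" and l: "l \<in> C" and p: "g $ k $ l \<noteq> 0"
    using q(1) R' by (auto simp: kl S_def)
  note quot = normalized_valuation_quotient[OF v]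
  obtain a where a: "v (g $ k $ l) = ereal a" using quot(2)[OF p] by blast
  \<comment> \<open>Zero entries have infinite valuation, so minimality over the nonzero entries
    extends to all.\<close>
  have min: "ereal (a + x $ k - y $ l - (x $ i - y $ j)) \<le> v (g $ i $ j)" if "i \<in> R'" "j \<in> C" for i j
  proof (cases "g $ i $ j = 0")
    case True
    then show ?thesis using v by (simp add: normalized_valuation_def)
  next
    case False
    then obtain b where "v (g $ i $ j) = ereal b" using quot(2) by blast
    moreover have "val (k, l) \<le> val (i, j)" using q(2)[of "(i, j)"] False that by (simp add: kl S_def)
    ultimately show ?thesis using a by (simp add: val_def)
  qed
  have fin: "v (- (b / g $ k $ l)) \<noteq> - \<infinity>" for b
    using quot(3)[OF p] by blast
  have "proj (elem_mat i k (- (g $ i $ l / g $ k $ l))) \<in> U_at v (pt I x)" if i: "i \<in> R - {k}" for i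
  proof (rule elem_mat_in_U_at[OF I])
    show "v (- (g $ i $ l / g $ k $ l)) \<noteq> - \<infinity>" by (rule fin)
  next
    assume "k \<in> I"
    \<comment> \<open>A pivot row in \<open>I\<close> means that no row outside \<open>I\<close>
      remained, so all rows of \<open>R\<close> took part in the minimum.\<close>
    then have "R \<subseteq> I" "R' = R" using k by (auto simp: R'_def split: if_splits)
    then show "i \<in> I \<and> ereal (x $ k - x $ i) \<le> v (- (g $ i $ l / g $ k $ l))"
      using i l min[of i l] a unfolding quot(1)[OF p] by (cases "v (g $ i $ l)") auto
  next
    show "i \<noteq> k" using i by simp
  qed
  moreover have "proj (elem_mat l j (- (g $ k $ j / g $ k $ l))) \<in> U_at v (pt UNIV y)"
    if j: "j \<in> C - {l}" for j
  proof (rule elem_mat_in_U_at)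
    show "v (- (g $ k $ j / g $ k $ l)) \<noteq> - \<infinity>" by (rule fin)
    show "l \<in> UNIV \<and> ereal (y $ j - y $ l) \<le> v (- (g $ k $ j / g $ k $ l))"
      using j k min[of k j] a unfolding quot(1)[OF p] by (cases "v (g $ k $ j)") auto
  qed (use j in auto)
  ultimately show ?thesis using k l p by blast
qed

theorem theorem4p9:
  fixes p :: nat
    and v :: "'k::field_char_0 \<Rightarrow> ereal"
    and x y :: "('n::finite) apt_point"
  assumes "finite_extension_of_Qp p v"
    and "x \<in> Lambda_bar"
    and "y \<in> Lambda"
  shows "carrier (PGL :: ('k ^ 'n ^ 'n) set monoid) =
    P_at v x <#>\<^bsub>PGL\<^esub> torus_normalizer <#>\<^bsub>PGL\<^esub> P_at v y"
proof
  interpret group "PGL :: ('k ^ 'n ^ 'n) set monoid" by (rule group_PGL)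
  have v: "normalized_valuation v" using assms(1) by (simp add: finite_extension_of_Qp_def)
  obtain I x0 where I: "I \<noteq> {}" and x: "x = pt I x0"
    using assms(2) by (auto simp: Lambda_bar_def Lambda_face_def)
  obtain y0 where y: "y = pt UNIV y0" using assms(3) by (auto simp: Lambda_def Lambda_face_def)
  have "N_at v z \<subseteq> carrier (PGL :: ('k ^ 'n ^ 'n) set monoid)" for z
    using torus_normalizer_subset by (auto simp: N_at_def)
  then have "P_at v z \<subseteq> carrier (PGL :: ('k ^ 'n ^ 'n) set monoid)" for z
    unfolding P_at_def by (intro set_mult_closed U_at_subset)
  then show "P_at v x <#>\<^bsub>PGL\<^esub> torus_normalizer <#>\<^bsub>PGL\<^esub> P_at v y \<subseteq>
      carrier (PGL :: ('k ^ 'n ^ 'n) set monoid)"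
    by (intro set_mult_closed torus_normalizer_subset)
  show "carrier (PGL :: ('k ^ 'n ^ 'n) set monoid) \<subseteq>
      P_at v x <#>\<^bsub>PGL\<^esub> torus_normalizer <#>\<^bsub>PGL\<^esub> P_at v y"
  proof
    fix h :: "('k ^ 'n ^ 'n) set"
    assume "h \<in> carrier PGL"
    then obtain g where g: "invertible g" and h: "h = proj g" by (auto simp: carrier_PGL)
    \<comment> \<open>Elimination works with matrices, hence the preimage of \<open>U_at v z\<close>
      under \<open>proj\<close>.\<close>
    define L where "L = (\<lambda>z. {A :: 'k ^ 'n ^ 'n. invertible A \<and> proj A \<in> U_at v z})"
    have L: "mat 1 \<in> L z" "A \<in> L z \<Longrightarrow> B \<in> L z \<Longrightarrow> A ** B \<in> L z" "A \<in> L z \<Longrightarrow> invertible A" for z A B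
      using subgroup.one_closed[OF subgroup_U_at, of v z] subgroup.m_closed[OF subgroup_U_at, of _ v z]
      by (auto simp: L_def invertible_mat proj_one invertible_mult simp flip: proj_mult)
    have pivot: "\<exists>k\<in>R. \<exists>l\<in>C. g $ k $ l \<noteq> 0 \<and>
        (\<forall>i\<in>R - {k}. elem_mat i k (- (g $ i $ l / g $ k $ l)) \<in> L x) \<and>
        (\<forall>j\<in>C - {l}. elem_mat l j (- (g $ k $ j / g $ k $ l)) \<in> L y)"
      if "R \<noteq> {}" "\<forall>k\<in>R. \<exists>l\<in>C. g $ k $ l \<noteq> 0" for g :: "'k ^ 'n ^ 'n" and R C
      using pivot_exists[OF v I that, of x0 y0]
      unfolding L_def x y mem_Collect_eq
      by (metis (no_types, lifting) DiffD2 insertI1 invertible_elem_mat)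
    have "\<exists>A\<in>L x. \<exists>B\<in>L y. \<exists>t w. (\<forall>i. t $ i \<noteq> 0) \<and> bij w \<and> A ** g ** B = diag_mat t ** perm_mat w"
      by (rule elimination_monomial; fact)
    then obtain A B t w where A: "A \<in> L x" and B: "B \<in> L y" and t: "\<forall>i. t $ i \<noteq> 0" and w: "bij w"
      and m: "A ** g ** B = diag_mat t ** perm_mat w" by metis
    let ?n = "proj (diag_mat t ** perm_mat w)"
    have inv: "invertible A" "invertible B" using A B L by auto
    have carr: "proj A \<in> carrier PGL" "proj B \<in> carrier PGL" "proj g \<in> carrier PGL"
      using inv g by (simp_all add: proj_in_PGL)
    have "?n = proj A \<otimes>\<^bsub>PGL\<^esub> proj g \<otimes>\<^bsub>PGL\<^esub> proj B"
      using inv g by (simp add: m[symmetric] proj_mult invertible_mult)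
    then have "h = inv\<^bsub>PGL\<^esub> proj A \<otimes>\<^bsub>PGL\<^esub> ?n \<otimes>\<^bsub>PGL\<^esub> inv\<^bsub>PGL\<^esub> proj B"
      using carr h by (simp add: m_assoc inv_solve_left)
    \<comment> \<open>The factor from \<open>N_at v z\<close> is taken to be the identity.\<close>
    moreover have "u \<in> P_at v z" if "u \<in> U_at v z" "z \<in> Lambda_bar" for u :: "('k ^ 'n ^ 'n) set" and z
      using one_in_N_at[OF v that(2)] that(1) U_at_subset[of v z] r_one[of u]
      unfolding P_at_def set_mult_def by force
    moreover have "y \<in> Lambda_bar" using assms(3) by (auto simp: Lambda_def Lambda_bar_def)
    moreover have "inv\<^bsub>PGL\<^esub> proj A \<in> U_at v x" "inv\<^bsub>PGL\<^esub> proj B \<in> U_at v y"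
      using A B subgroup.m_inv_closed[OF subgroup_U_at, of "proj A"]
        subgroup.m_inv_closed[OF subgroup_U_at, of "proj B"] by (simp_all add: L_def)
    ultimately show "h \<in> P_at v x <#>\<^bsub>PGL\<^esub> torus_normalizer <#>\<^bsub>PGL\<^esub> P_at v y"
      using monomial_in_normalizer[OF t w] assms(2) unfolding set_mult_def by blast
  qed
qed

end
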